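(* Let an instance of the network design setting ($\mathcal{N}=(N,E)$, costs $b,c$, arc lengths $d$, O/D pairs $W$, demands $g$, private utilities $u$, and $\alpha\in[0,1]$) be given, and let $\lambda\in(0,1)$. Then every $\lambda$-cent-dian, i.e. every subgraph $\mathcal{S}\in\mathcal{N}^\alpha$ minimizing $H_\lambda(\mathcal{S})=\lambda F_c(\mathcal{S})+(1-\lambda)F_m(\mathcal{S})$ over $\mathcal{N}^\alpha$, belongs to $\mathcal{PO}^\alpha_2$.
   Context: Setting. $\mathcal{N}=(N,E)$ is a finite undirected graph with node costs $b_i\ge 0$ ($i\in N$) and edge costs $c_e\ge 0$ ($e\in E$). Each edge $\{i,j\}\in E$ gives two arcs $(i,j)$ and $(j,i)$; each arc $a$ has a length $d_a\ge 0$. $W\subset N\times N$ is a finite nonempty set of origin/destination pairs $w=(w^s,w^t)$ with $w^s\ne w^t$; each $w\in W$ has a demand $g^w>0$ and a private utility $u^w>0$. Put $G=\sum_{w\in W}g^w$. Feasible subgraphs. For $\alpha\in[0,1]$, $\mathcal{N}^\alpha$ is the set of all subgraphs $\mathcal{S}=(N_{\mathcal S},E_{\mathcal S})$ of $\mathcal N$ (the empty subgraph is allowed) with $\sum_{i\in N_{\mathcal S}}b_i+\sum_{e\in E_{\mathcal S}}c_e\le \alpha\big(\sum_{i\in N}b_i+\sum_{e\in E}c_e\big)$. Lengths. For a subgraph $\mathcal S$ and $w\in W$, $d_{\mathcal S}(w)$ is the length of a shortest path from $w^s$ to $w^t$ using arcs arising from edges of $\mathcal S$, with $d_{\mathcal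 S}(w)=+\infty$ if no such path exists in $\mathcal{S}$; and $\ell_{\mathcal S}(w)=\min\{d_{\mathcal S}(w),u^w\}$. Objectives. $F_m(\mathcal S)=\frac1G\sum_{w\in W}g^w\ell_{\mathcal S}(w)$ (median objective) and $F_c(\mathcal S)=\max_{w\in W}\ell_{\mathcal S}(w)$ (center objective). Pareto-optimality. $\mathcal{PO}^\alpha_2$ is the set of all $\mathcal S\in\mathcal N^\alpha$ for which there is no $\mathcal S'\in\mathcal N^\alpha$ with $F_m(\mathcal S')\le F_m(\mathcal S)$ and $F_c(\mathcal S')\le F_c(\mathcal S)$, at least one of the two inequalities being strict. *)

theory Defs
  imports Complex_Main "Graph_Theory.Graph_Theory"
begin

record 'v ugraph =
  nodes :: "'v set"
  edges :: "'v set set"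

definition finite_ugraph :: "'v ugraph \<Rightarrow> bool" where
  "finite_ugraph N \<longleftrightarrow> finite (nodes N) \<and> (\<forall>e\<in>edges N. e \<subseteq> nodes N \<and> card e = 2)"

definition is_subgraph :: "'v ugraph \<Rightarrow> 'v ugraph \<Rightarrow> bool" where
  "is_subgraph S N \<longleftrightarrow>
     nodes S \<subseteq> nodes N \<and> edges S \<subseteq> edges N \<and> (\<forall>e\<in>edges S. e \<subseteq> nodes S)"

definition arcs_digraph :: "'v ugraph \<Rightarrow> ('v, 'v \<times> 'v) pre_digraph" where
  "arcs_digraph S =
     \<lparr>verts = nodes S, arcs = {(i, j). {i, j} \<in> edges S}, tail = fst, head = snd\<rparr>"

record 'v network_design =
  network :: "'v ugraph"
  node_cost :: "'v \<Rightarrow> real"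
  edge_cost :: "'v set \<Rightarrow> real"
  arc_length :: "'v \<times> 'v \<Rightarrow> real"
  od_pairs :: "('v \<times> 'v) set"
  demand :: "'v \<times> 'v \<Rightarrow> real"
  utility :: "'v \<times> 'v \<Rightarrow> real"

definition valid_instance :: "'v network_design \<Rightarrow> bool" where
  "valid_instance I \<longleftrightarrow>
     finite_ugraph (network I) \<and>
     (\<forall>i\<in>nodes (network I). 0 \<le> node_cost I i) \<and>
     (\<forall>e\<in>edges (network I). 0 \<le> edge_cost I e) \<and>
     (\<forall>a\<in>arcs (arcs_digraph (network I)). 0 \<le> arc_length I a) \<and>
     finite (od_pairs I) \<and> od_pairs I \<noteq> {} \<and>
     od_pairs I \<subseteq> nodes (network I) \<times> nodes (network I) \<and>
     (\<forall>w\<in>od_pairs I. fst w \<noteq> snd w \<and> 0 < demand I w \<and> 0 < utility I w)"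

definition construction_cost :: "'v network_design \<Rightarrow> 'v ugraph \<Rightarrow> real" where
  "construction_cost I S = (\<Sum>i\<in>nodes S. node_cost I i) + (\<Sum>e\<in>edges S. edge_cost I e)"

definition feasible_subgraphs :: "'v network_design \<Rightarrow> real \<Rightarrow> 'v ugraph set" where
  "feasible_subgraphs I \<alpha> =
     {S. is_subgraph S (network I) \<and>
         construction_cost I S \<le> \<alpha> * construction_cost I (network I)}"

(* The constant mu of Graph_Theory is an infimum over walks in the extended reals, so it is
   infinite when no path exists.  Lemma sp_dist_attained below confirms that, for nonnegative
   lengths, it is otherwise the length of a path. *)
definition sp_dist :: "'v network_design \<Rightarrow> 'v ugraph \<Rightarrow> 'v \<times> 'v \<Rightarrow> ereal" where
  "sp_dist I S w = wf_digraph.\<mu> (arcs_digraph S) (arc_length I) (fst w) (snd w)"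

(* The minimum is taken in the extended reals; it is finite by lemma ereal_travel_length. *)
definition travel_length :: "'v network_design \<Rightarrow> 'v ugraph \<Rightarrow> 'v \<times> 'v \<Rightarrow> real" where
  "travel_length I S w = real_of_ereal (min (sp_dist I S w) (ereal (utility I w)))"

definition total_demand :: "'v network_design \<Rightarrow> real" where
  "total_demand I = (\<Sum>w\<in>od_pairs I. demand I w)"

definition F_m :: "'v network_design \<Rightarrow> 'v ugraph \<Rightarrow> real" where
  "F_m I S = 1 / total_demand I * (\<Sum>w\<in>od_pairs I. demand I w * travel_length I S w)"

definition F_c :: "'v network_design \<Rightarrow> 'v ugraph \<Rightarrow> real" where
  "F_c I S = Max (travel_length I S ` od_pairs I)"

definition H :: "'v network_design \<Rightarrow> real \<Rightarrow> 'v ugraph \<Rightarrow> real" where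
  "H I l S = l * F_c I S + (1 - l) * F_m I S"

definition cent_dian :: "'v network_design \<Rightarrow> real \<Rightarrow> real \<Rightarrow> 'v ugraph \<Rightarrow> bool" where
  "cent_dian I \<alpha> l S \<longleftrightarrow>
     S \<in> feasible_subgraphs I \<alpha> \<and> (\<forall>S'\<in>feasible_subgraphs I \<alpha>. H I l S \<le> H I l S')"

definition PO2 :: "'v network_design \<Rightarrow> real \<Rightarrow> 'v ugraph set" where
  "PO2 I \<alpha> =
     {S \<in> feasible_subgraphs I \<alpha>.
        \<not> (\<exists>S'\<in>feasible_subgraphs I \<alpha>.
              F_m I S' \<le> F_m I S \<and> F_c I S' \<le> F_c I S \<and>
              (F_m I S' < F_m I S \<or> F_c I S' < F_c I S))}"

lemma fin_digraph_subgraph: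
  assumes "finite_ugraph N" "is_subgraph S N"
  shows "fin_digraph (arcs_digraph S)"
proof
  have e: "{i, j} \<subseteq> nodes S" if "{i, j} \<in> edges S" for i j
    using that assms(2) unfolding is_subgraph_def by blast
  show fin: "finite (verts (arcs_digraph S))"
    using assms by (auto simp: arcs_digraph_def finite_ugraph_def is_subgraph_def
        intro: finite_subset)
  have "arcs (arcs_digraph S) \<subseteq> nodes S \<times> nodes S"
    using e by (auto simp: arcs_digraph_def)
  then show "finite (arcs (arcs_digraph S))"
    using fin by (auto simp: arcs_digraph_def intro: finite_subset)
  show "tail (arcs_digraph S) a \<in> verts (arcs_digraph S)"
    "head (arcs_digraph S) a \<in> verts (arcs_digraph S)"
    if "a \<in> arcs (arcs_digraph S)" for a
    using that e by (auto simp: arcs_digraph_def)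
qed

lemma subgraph_arc_length_nonneg:
  assumes "valid_instance I" "is_subgraph S (network I)" "a \<in> arcs (arcs_digraph S)"
  shows "0 \<le> arc_length I a"
  using assms by (auto simp: valid_instance_def is_subgraph_def arcs_digraph_def)

lemma sp_dist_attained:
  assumes "valid_instance I" "is_subgraph S (network I)"
    and "fst w \<rightarrow>\<^sup>*\<^bsub>arcs_digraph S\<^esub> snd w"
  shows "\<exists>p. pre_digraph.apath (arcs_digraph S) (fst w) p (snd w) \<and>
             sp_dist I S w = ereal (\<Sum>a\<leftarrow>p. arc_length I a)"
proof -
  interpret fin_digraph "arcs_digraph S"
    using assms by (auto simp: valid_instance_def intro: fin_digraph_subgraph)
  show ?thesis
    using min_cost_awalk[OF assms(3), of "arc_length I"] subgraph_arc_length_nonneg[OF assms(1,2)]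
    by (auto simp: sp_dist_def awalk_cost_def)
qed

lemma sp_dist_infinite_iff:
  assumes "valid_instance I" "is_subgraph S (network I)"
  shows "sp_dist I S w = \<infinity> \<longleftrightarrow> \<not> fst w \<rightarrow>\<^sup>*\<^bsub>arcs_digraph S\<^esub> snd w"
proof -
  interpret fin_digraph "arcs_digraph S"
    using assms by (auto simp: valid_instance_def intro: fin_digraph_subgraph)
  show ?thesis
    using \<mu>_reach_conv[of "arc_length I" "fst w" "snd w"] by (auto simp: sp_dist_def)
qed

lemma ereal_travel_length:
  assumes "valid_instance I" "is_subgraph S (network I)"
  shows "ereal (travel_length I S w) = min (sp_dist I S w) (ereal (utility I w))"
proof (cases "sp_dist I S w = \<infinity>")
  case True
  then show ?thesis by (simp add: travel_length_def)
next
  case False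
  then obtain r where "sp_dist I S w = ereal r"
    using sp_dist_infinite_iff[OF assms] sp_dist_attained[OF assms] by blast
  then show ?thesis by (simp add: travel_length_def min_def)
qed

end

theory Submission
  imports Defs
begin

text \<open>Both weights of the scalarization are strictly positive, so a strict gain in either
  objective cannot be absorbed by the other one: a Pareto improvement on a minimizer would be a
  feasible subgraph of strictly smaller weighted value. This is where the endpoints of the
  weight interval fail, since there one objective is ignored.\<close>

lemma H_less_of_dominates:
  assumes "0 < l" "l < 1"
    and "F_m I S' \<le> F_m I S" "F_c I S' \<le> F_c I S"
    and "F_m I S' < F_m I S \<or> F_c I S' < F_c I S"
  shows "H I l S' < H I l S"
  using assms(5)
proof
  assume "F_m I S' < F_m I S"
  then show ?thesis
    unfolding H_def using assms(1-4) by (intro add_le_less_mono) simp_all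
next
  assume "F_c I S' < F_c I S"
  then show ?thesis
    unfolding H_def using assms(1-4) by (intro add_less_le_mono) simp_all
qed

theorem proposition1:
  fixes I :: "'v network_design" and \<alpha> l :: real and S :: "'v ugraph"
  assumes "valid_instance I"
    and "0 \<le> \<alpha>" "\<alpha> \<le> 1"
    and "0 < l" "l < 1"
    and "cent_dian I \<alpha> l S"
  shows "S \<in> PO2 I \<alpha>"
proof -
  have feasible: "S \<in> feasible_subgraphs I \<alpha>"
    using assms(6) unfolding cent_dian_def by blast
  have minimal: "H I l S \<le> H I l S'" if "S' \<in> feasible_subgraphs I \<alpha>" for S'
    using assms(6) that unfolding cent_dian_def by blast
  show ?thesis
    unfolding PO2_def
    using feasible minimal H_less_of_dominates[OF assms(4,5), of I _ S] by fastforce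
qed

end
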